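(* There is an absolute constant $c>0$ such that for every sufficiently large integer $d$ and every $\varepsilon \le \frac{1}{8}$, every nonadaptive, one-sided error unateness tester with distance parameter $\varepsilon$ for functions $f:\{0,1\}^d \to \{0,1\}$ must make at least $c\cdot \frac{d}{\log d}$ queries in the worst case. That is, the query complexity of nonadaptive, one-sided error unateness testing of Boolean functions on $\{0,1\}^d$ is $\Omega\!\left(\frac{d}{\log d}\right)$.
   Context: A function $f:\{0,1\}^d \to \{0,1\}$ is unate if for each coordinate $i \in [d]$, $f$ is either nondecreasing along coordinate $i$ (i.e., $f(x) \le f(y)$ whenever $x,y$ differ only in coordinate $i$ with $x_i=0$, $y_i=1$) or nonincreasing along coordinate $i$ (i.e., $f(x)\ge f(y)$ for all such pairs). The distance of $f$ from unate is the minimum, over unate $g:\{0,1\}^d\to\{0,1\}$, of the fraction of points $x\in\{0,1\}^d$ with $f(x)\neq g(x)$; $f$ is $\varepsilon$-far from unate if this distance is at least $\varepsilon$. A unateness tester with distance parameter $\varepsilon\in(0,1)$ is a randomized algorithm with query access to $f$ (each query $x$ returns $f(x)$) that accepts with probability at least $2/3$ if $f$ is unate and rejects with probability at least $2/3$ if $f$ is $\varepsilon$-far from unate. It has one-sided error if it accepts every unate function with probability $1$. It is nonadaptive if it chooses all of its queries before seeing any answers (the set of queries may be random but does not depend on the answers). The number of queries is the maximum number of queries made, over all inputs and random choices. *)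

theory Defs
  imports "HOL-Probability.Probability" "HOL-Library.FuncSet"
begin

text \<open>The coordinates \<open>1, \<dots>, d\<close> are indexed by \<open>{..<d}\<close>, and \<open>False < True\<close> plays the
  role of \<open>0 < 1\<close>. Points are extensional, so that \<open>cube d\<close> has exactly \<open>2 ^ d\<close> elements.\<close>

type_synonym point = "nat \<Rightarrow> bool"

definition cube :: "nat \<Rightarrow> point set" where
  "cube d = {..<d} \<rightarrow>\<^sub>E (UNIV :: bool set)"

text \<open>A function on the cube is given by a function on all of \<open>point\<close>; all notions below
  depend on its values on \<open>cube d\<close> only.\<close>

definition edge :: "nat \<Rightarrow> nat \<Rightarrow> point \<Rightarrow> point \<Rightarrow> bool" where
  "edge d i x y \<longleftrightarrow> x \<in> cube d \<and> y \<in> cube d \<and> (\<forall>j\<in>{..<d} - {i}. x j = y j) \<and>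
     x i = False \<and> y i = True"

definition nondecreasing_along :: "nat \<Rightarrow> nat \<Rightarrow> (point \<Rightarrow> bool) \<Rightarrow> bool" where
  "nondecreasing_along d i f \<longleftrightarrow> (\<forall>x y. edge d i x y \<longrightarrow> f x \<le> f y)"

definition nonincreasing_along :: "nat \<Rightarrow> nat \<Rightarrow> (point \<Rightarrow> bool) \<Rightarrow> bool" where
  "nonincreasing_along d i f \<longleftrightarrow> (\<forall>x y. edge d i x y \<longrightarrow> f x \<ge> f y)"

definition unate :: "nat \<Rightarrow> (point \<Rightarrow> bool) \<Rightarrow> bool" where
  "unate d f \<longleftrightarrow> (\<forall>i<d. nondecreasing_along d i f \<or> nonincreasing_along d i f)"

definition rel_dist :: "nat \<Rightarrow> (point \<Rightarrow> bool) \<Rightarrow> (point \<Rightarrow> bool) \<Rightarrow> real" where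
  "rel_dist d f g = real (card {x \<in> cube d. f x \<noteq> g x}) / real (card (cube d))"

definition dist_unate :: "nat \<Rightarrow> (point \<Rightarrow> bool) \<Rightarrow> real" where
  "dist_unate d f = Min (rel_dist d f ` {g. unate d g})"

lemma finite_cube: "finite (cube d)"
  by (simp add: cube_def finite_PiE)

lemma card_cube: "card (cube d) = 2 ^ d"
  by (simp add: cube_def card_PiE)

lemma finite_rel_dist_image: "finite (rel_dist d f ` G)"
proof -
  have "rel_dist d f ` G \<subseteq> (\<lambda>S. real (card S) / real (card (cube d))) ` Pow (cube d)"
    by (auto simp: rel_dist_def)
  then show ?thesis
    by (rule finite_subset) (simp add: finite_cube)
qed

lemma unate_exists: "{g. unate d g} \<noteq> {}"
proof -
  have "unate d (\<lambda>_. False)"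
    by (simp add: unate_def nondecreasing_along_def)
  then show ?thesis by blast
qed

definition far_from_unate :: "nat \<Rightarrow> real \<Rightarrow> (point \<Rightarrow> bool) \<Rightarrow> bool" where
  "far_from_unate d \<epsilon> f \<longleftrightarrow> dist_unate d f \<ge> \<epsilon>"

text \<open>A nonadaptive algorithm draws, before seeing any answer, a list of queries together with
  the rule deciding from the list of answers whether to accept. The two components may be
  correlated, so all randomness (including that of the decision) is covered. For a bounded number
  of queries in \<open>cube d\<close> there are only finitely many such deterministic strategies up to
  behaviour, so discrete distributions lose no generality.\<close>

type_synonym nonadaptive_algorithm = "(point list \<times> (bool list \<Rightarrow> bool)) pmf"

definition accept_prob :: "nonadaptive_algorithm \<Rightarrow> (point \<Rightarrow> bool) \<Rightarrow> real" where
  "accept_prob T f = measure_pmf.prob T {(qs, decide). decide (map f qs)}"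

definition reject_prob :: "nonadaptive_algorithm \<Rightarrow> (point \<Rightarrow> bool) \<Rightarrow> real" where
  "reject_prob T f = measure_pmf.prob T {(qs, decide). \<not> decide (map f qs)}"

definition nonadaptive_unateness_tester :: "nat \<Rightarrow> real \<Rightarrow> nonadaptive_algorithm \<Rightarrow> bool" where
  "nonadaptive_unateness_tester d \<epsilon> T \<longleftrightarrow>
     (\<forall>(qs, decide) \<in> set_pmf T. set qs \<subseteq> cube d) \<and>
     (\<forall>f. unate d f \<longrightarrow> accept_prob T f \<ge> 2 / 3) \<and>
     (\<forall>f. far_from_unate d \<epsilon> f \<longrightarrow> reject_prob T f \<ge> 2 / 3)"

definition one_sided_error :: "nat \<Rightarrow> nonadaptive_algorithm \<Rightarrow> bool" where
  "one_sided_error d T \<longleftrightarrow> (\<forall>f. unate d f \<longrightarrow> accept_prob T f = 1)"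

text \<open>Taken in \<open>enat\<close>, so that an algorithm without a bound on its number of queries has
  \<open>num_queries T = \<infinity>\<close>.\<close>

definition num_queries :: "nonadaptive_algorithm \<Rightarrow> enat" where
  "num_queries T = (SUP (qs, decide) \<in> set_pmf T. enat (length qs))"

end

theory Submission
  imports Defs
begin

text \<open>The hard functions are the parities \<open>x\<^sub>i \<oplus> x\<^sub>j\<close>, which are \<open>1/4\<close>-far from unate since this is
  so on every two-dimensional face. A one-sided tester can only reject if the answers on its query
  set \<open>Q\<close> do not extend to a unate function. They do extend iff there is an orientation \<open>r\<close> of
  the coordinates such that any two points of \<open>Q\<close> with values \<open>0\<close> and \<open>1\<close> differ in a coordinate
  in which the second one agrees with \<open>r\<close>. If all such pairs have distance at least
  \<open>2 log d\<close>, then a random \<open>r\<close> works. On the other hand, a spanning forest of the graph of pairs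
  at distance less than \<open>2 log d\<close> shows that only \<open>O(|Q| log d)\<close> coordinates vary within these
  pairs. So if \<open>|Q|\<close> is much smaller than \<open>d / log d\<close>, then for most parities all close pairs have
  equal values, and the tester accepts.\<close>

section \<open>Parities and their distance from unate functions\<close>

definition diff_coords :: "nat \<Rightarrow> point \<Rightarrow> point \<Rightarrow> nat set" where
  "diff_coords d x y = {i. i < d \<and> x i \<noteq> y i}"

definition parity2 :: "nat \<Rightarrow> nat \<Rightarrow> point \<Rightarrow> bool" where
  "parity2 i j x \<longleftrightarrow> x i \<noteq> x j"

lemma fun_upd_in_cube: "x \<in> cube d \<Longrightarrow> i < d \<Longrightarrow> x(i := b) \<in> cube d"
  by (auto simp: cube_def PiE_iff extensional_def)

lemma edge_fun_upd: "x \<in> cube d \<Longrightarrow> i < d \<Longrightarrow> edge d i (x(i := False)) (x(i := True))"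
  by (simp add: edge_def fun_upd_in_cube)

text \<open>Agreement on the whole face would make \<open>g\<close> strictly increase in direction
  \<open>i\<close> for \<open>b = False\<close> and strictly decrease for
  \<open>b = True\<close>.\<close>

lemma parity2_neq_unate_on_face:
  assumes "unate d g" "x \<in> cube d" "i < d" "j < d" "i \<noteq> j"
  shows "\<exists>a b. parity2 i j (x(i := a, j := b)) \<noteq> g (x(i := a, j := b))"
proof (rule ccontr)
  assume "\<not> ?thesis"
  then have eq: "g (x(i := a, j := b)) \<longleftrightarrow> a \<noteq> b" for a b
    using \<open>i \<noteq> j\<close> by (auto simp: parity2_def)
  have e: "edge d i (x(i := False, j := b)) (x(i := True, j := b))" for b
    using edge_fun_upd[of "x(j := b)" d i] assms fun_upd_in_cube[of x d j b]
    by (simp add: fun_upd_twist)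
  from \<open>unate d g\<close> \<open>i < d\<close> consider "nondecreasing_along d i g" | "nonincreasing_along d i g"
    by (auto simp: unate_def)
  then show False
  proof cases
    case 1
    then show False using e[of True] eq unfolding nondecreasing_along_def
      by (metis le_boolD)
  next
    case 2
    then show False using e[of False] eq unfolding nonincreasing_along_def
      by (metis le_boolD)
  qed
qed

text \<open>Each face in directions \<open>i\<close>, \<open>j\<close> contains a disagreement, from
  which every point of the face arises by resetting two bits; so four copies of the disagreement set
  cover the cube.\<close>

lemma rel_dist_parity2_unate:
  assumes "unate d g" "i < d" "j < d" "i \<noteq> j"
  shows "rel_dist d (parity2 i j) g \<ge> 1 / 4"
proof -
  define D where "D = {x \<in> cube d. parity2 i j x \<noteq> g x}"
  define h where "h = (\<lambda>(a, b, y::point). y(i := a, j := b))"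
  have finD: "finite D"
    using finite_cube[of d] by (simp add: D_def)
  have "cube d \<subseteq> h ` ((UNIV::bool set) \<times> (UNIV::bool set) \<times> D)"
  proof
    fix x assume x: "x \<in> cube d"
    obtain a b where "parity2 i j (x(i := a, j := b)) \<noteq> g (x(i := a, j := b))"
      using parity2_neq_unate_on_face[OF assms(1) x assms(2-4)] by blast
    then have "x(i := a, j := b) \<in> D"
      using x assms by (simp add: D_def fun_upd_in_cube)
    moreover have "x = h (x i, x j, x(i := a, j := b))"
      using \<open>i \<noteq> j\<close> by (auto simp: h_def)
    ultimately show "x \<in> h ` ((UNIV::bool set) \<times> (UNIV::bool set) \<times> D)"
      by blast
  qed
  then have "card (cube d) \<le> card ((UNIV::bool set) \<times> (UNIV::bool set) \<times> D)"
    using finD by (meson finite_SigmaI finite surj_card_le)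
  then have "2 ^ d \<le> 4 * card D"
    by (simp add: card_cartesian_product card_cube)
  then have "(2::real) ^ d \<le> 4 * real (card D)"
    by (metis of_nat_le_iff of_nat_mult of_nat_numeral of_nat_power)
  then show ?thesis
    by (simp add: rel_dist_def card_cube D_def field_simps)
qed

lemma parity2_far_from_unate:
  assumes "i < d" "j < d" "i \<noteq> j" "\<epsilon> \<le> 1 / 4"
  shows "far_from_unate d \<epsilon> (parity2 i j)"
proof -
  have "1 / 4 \<le> dist_unate d (parity2 i j)"
    unfolding dist_unate_def
  proof (rule Min.boundedI)
    fix a assume "a \<in> rel_dist d (parity2 i j) ` {g. unate d g}"
    then show "1 / 4 \<le> a"
      using rel_dist_parity2_unate[OF _ assms(1-3)] by blast
  qed (use unate_exists[of d] in \<open>simp_all add: finite_rel_dist_image\<close>)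
  with assms show ?thesis
    by (simp add: far_from_unate_def)
qed

section \<open>Extension to unate functions\<close>

lemma unate_extension:
  assumes "\<And>x y. x \<in> Q \<Longrightarrow> y \<in> Q \<Longrightarrow> \<not> f x \<Longrightarrow> f y \<Longrightarrow> \<exists>i<d. x i \<noteq> y i \<and> y i = r i"
  obtains g where "unate d g" "\<And>x. x \<in> Q \<Longrightarrow> g x = f x"
proof -
  \<comment> \<open>The least extension that is monotone in the order oriented by \<open>r\<close>: the upward closure of
    the points of \<open>Q\<close> with value \<open>1\<close>.\<close>
  define g where "g z \<longleftrightarrow> (\<exists>y\<in>Q. f y \<and> (\<forall>i<d. y i = r i \<longrightarrow> z i = r i))" for z
  \<comment> \<open>Moving coordinate \<open>i\<close> to \<open>r i\<close> preserves the value 1,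
    so \<open>r i\<close> fixes the direction of \<open>g\<close> along \<open>i\<close>.\<close>
  have "g z'" if "g z" "\<forall>k\<in>{..<d} - {i}. z k = z' k" "z' i = r i" for z z' i
    using that unfolding g_def by (metis Diff_iff lessThan_iff singletonD)
  then have "nondecreasing_along d i g \<or> nonincreasing_along d i g" for i
    unfolding nondecreasing_along_def nonincreasing_along_def edge_def
    by (cases "r i") (auto simp: le_bool_def)
  then have "unate d g"
    by (simp add: unate_def)
  \<comment> \<open>If \<open>f x\<close> holds, \<open>x\<close> is its own witness; otherwise a
    witness \<open>y\<close> would contradict the assumption on \<open>x\<close>,
    \<open>y\<close>.\<close>
  moreover have "g x = f x" if "x \<in> Q" for x
    using assms that unfolding g_def by metis
  ultimately show ?thesis ..
qed

lemma card_cube_fixed: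
  assumes "S \<subseteq> {..<d}"
  shows "card {r \<in> cube d. \<forall>i\<in>S. r i = a i} = 2 ^ (d - card S)"
proof -
  have "{r \<in> cube d. \<forall>i\<in>S. r i = a i} = (\<Pi>\<^sub>E i\<in>{..<d}. if i \<in> S then {a i} else UNIV)"
    using assms by (auto simp: cube_def PiE_iff split: if_splits) (auto simp: extensional_def)
  moreover have "card {i. i < d \<and> i \<notin> S} = d - card S"
  proof -
    have "{i. i < d \<and> i \<notin> S} = {..<d} - S" by auto
    then show ?thesis
      using assms by (simp add: card_Diff_subset finite_subset[OF assms])
  qed
  moreover have "(\<Prod>i<d. card (if i \<in> S then {a i} else UNIV)) = (\<Prod>i<d. if i \<in> S then 1 else 2)"
    by (rule prod.cong) auto
  ultimately show ?thesis
    by (simp add: card_PiE prod.If_cases Collect_conj_eq[symmetric] Int_def)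
qed

text \<open>Union bound over a uniform \<open>r\<close>: a pair fails iff \<open>r\<close> agrees
  with \<open>x\<close> on all of the at least \<open>k\<close> differing coordinates, which has
  probability at most \<open>1 / 2 ^ k\<close>.\<close>

lemma orientation_exists:
  assumes "finite P" "card P < 2 ^ k"
    and far: "\<And>x y. (x, y) \<in> P \<Longrightarrow> k \<le> card (diff_coords d x y)"
  obtains r where "\<And>x y. (x, y) \<in> P \<Longrightarrow> \<exists>i<d. x i \<noteq> y i \<and> y i = r i"
proof (cases "P = {}")
  case False
  define bad where "bad = (\<lambda>(x, y). {r \<in> cube d. \<forall>i\<in>diff_coords d x y. r i = x i})"
  have sub: "diff_coords d x y \<subseteq> {..<d}" for x y
    by (auto simp: diff_coords_def)
  from False obtain x y where "(x, y) \<in> P" by auto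
  \<comment> \<open>Subtraction truncates, so \<open>2 ^ k * 2 ^ (d - k)\<close> is the size of the
    cube only for \<open>k \<le> d\<close>.\<close>
  then have "k \<le> d"
    using far[of x y] card_mono[OF finite_lessThan sub[of x y]] by simp
  have "card (\<Union>p\<in>P. bad p) \<le> (\<Sum>p\<in>P. card (bad p))"
    by (rule card_UN_le[OF \<open>finite P\<close>])
  also have "\<dots> \<le> (\<Sum>p\<in>P. 2 ^ (d - k))"
  proof (rule sum_mono)
    fix p assume "p \<in> P"
    then show "card (bad p) \<le> 2 ^ (d - k)"
      using far by (cases p) (auto simp: bad_def card_cube_fixed[OF sub] intro!: power_increasing diff_le_mono2)
  qed
  also have "\<dots> < 2 ^ k * 2 ^ (d - k)"
    using \<open>card P < 2 ^ k\<close> by simp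
  also have "\<dots> = card (cube d)"
    using \<open>k \<le> d\<close> by (simp add: card_cube flip: power_add)
  finally have "card (\<Union>p\<in>P. bad p) < card (cube d)" .
  moreover have "finite (\<Union>p\<in>P. bad p)"
    using \<open>finite P\<close> finite_cube by (auto simp: bad_def)
  ultimately have "\<not> cube d \<subseteq> (\<Union>p\<in>P. bad p)"
    using card_mono leD by blast
  then obtain r where r: "r \<in> cube d" "r \<notin> (\<Union>p\<in>P. bad p)"
    by blast
  show ?thesis
  proof (rule that)
    fix x y assume "(x, y) \<in> P"
    with r obtain i where "i \<in> diff_coords d x y" "r i \<noteq> x i"
      by (auto simp: bad_def)
    then show "\<exists>i<d. x i \<noteq> y i \<and> y i = r i"
      by (intro exI[of _ i]) (simp add: diff_coords_def)
  qed
qed auto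

section \<open>Coordinates varying within close pairs\<close>

text \<open>\<open>D x y\<close> is the label of the pair \<open>x\<close>, \<open>y\<close>, and \<open>B\<close> the union of the labels in a spanning
  forest of the graph of pairs with small label.\<close>

lemma small_labels_cover:
  fixes D :: "'a \<Rightarrow> 'a \<Rightarrow> 'b set"
  assumes "finite Q"
    and refl: "\<And>x. D x x = {}"
    and sym: "\<And>x y. D x y = D y x"
    and tri: "\<And>x y z. D x z \<subseteq> D x y \<union> D y z"
    and fin: "\<And>x y. finite (D x y)"
  obtains B where "finite B" "card B \<le> k * card Q"
    "\<And>x y. x \<in> Q \<Longrightarrow> y \<in> Q \<Longrightarrow> card (D x y) \<le> k \<Longrightarrow> D x y \<subseteq> B"
proof -
  \<comment> \<open>Here \<open>c\<close> names the components of a partial spanning forest and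
    \<open>B\<close> holds the labels of its edges; each merge removes one component and adds at
    most \<open>k\<close> elements to \<open>B\<close>.\<close>
  define inv where "inv c B \<longleftrightarrow> finite B \<and> card B + k * card (c ` Q) \<le> k * card Q \<and>
      (\<forall>x\<in>Q. \<forall>y\<in>Q. c x = c y \<longrightarrow> D x y \<subseteq> B)" for c :: "'a \<Rightarrow> 'a" and B
  have "inv id {}"
    by (simp add: inv_def refl)
  \<comment> \<open>With the fewest components, no pair with small label can join two of
    them.\<close>
  then obtain c where c: "\<exists>B. inv c B"
    and least: "\<forall>c'. (\<exists>B. inv c' B) \<longrightarrow> card (c ` Q) \<le> card (c' ` Q)"
    using ex_has_least_nat[of "\<lambda>c. \<exists>B. inv c B" id "\<lambda>c. card (c ` Q)"] by metis
  from c obtain B where inv: "inv c B" ..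
  from least have least: "card (c ` Q) \<le> card (c' ` Q)" if "inv c' B'" for c' B'
    using that by blast
  have "D x y \<subseteq> B" if xy: "x \<in> Q" "y \<in> Q" "card (D x y) \<le> k" for x y
  proof (cases "c x = c y")
    case True
    then show ?thesis using inv xy by (simp add: inv_def)
  next
    case False
    define c' where "c' = (\<lambda>z. if c z = c x then c y else c z)"
    have "c' ` Q = c ` Q - {c x}"
      using False xy by (auto simp: c'_def image_iff)
    then have card: "card (c ` Q) = Suc (card (c' ` Q))"
      using \<open>finite Q\<close> xy by (metis card.remove finite_imageI imageI)
    have "D u v \<subseteq> B \<union> D x y" if uv: "u \<in> Q" "v \<in> Q" "c' u = c' v" for u v
    proof -
      have old: "D a b \<subseteq> B" if "a \<in> Q" "b \<in> Q" "c a = c b" for a b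
        using inv that by (simp add: inv_def)
      consider "c u = c v" | "c u = c x" "c v = c y" | "c u = c y" "c v = c x"
        using uv(3) by (auto simp: c'_def split: if_splits)
      then show ?thesis
      proof cases
        case 1
        then show ?thesis using old uv by blast
      next
        case 2
        then show ?thesis
          using old[of u x] old[of y v] uv xy tri[of u v x] tri[of x v y] by auto
      next
        case 3
        then show ?thesis
          using old[of u y] old[of x v] uv xy tri[of u v y] tri[of y v x] sym[of x y] by auto
      qed
    qed
    moreover have "card (B \<union> D x y) + k * card (c' ` Q) \<le> k * card Q"
      using inv card xy(3) card_Un_le[of B "D x y"] by (simp add: inv_def)
    ultimately have "inv c' (B \<union> D x y)"
      using inv fin by (simp add: inv_def)
    from least[OF this] card show ?thesis by simp
  qed
  with inv show ?thesis
    by (intro that[of B]) (auto simp: inv_def)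
qed

lemma coords_of_close_pairs:
  assumes "finite Q"
  obtains B where "finite B" "card B \<le> k * card Q"
    "\<And>x y. x \<in> Q \<Longrightarrow> y \<in> Q \<Longrightarrow> card (diff_coords d x y) \<le> k \<Longrightarrow> diff_coords d x y \<subseteq> B"
  by (rule small_labels_cover[OF assms, of "diff_coords d" k]) (auto simp: diff_coords_def)

section \<open>Rejection on a fixed set of queries\<close>

text \<open>Points with different parities differ in exactly one of \<open>i\<close>,
  \<open>j\<close>, hence outside \<open>B\<close>, so they are more than \<open>k\<close> apart; at
  most \<open>card Q * card Q\<close> ordered pairs remain to be oriented.\<close>

lemma parity2_extension:
  assumes "finite Q" "card Q * card Q < 2 ^ k" "i < d" "j < d"
    and close: "\<And>x y. x \<in> Q \<Longrightarrow> y \<in> Q \<Longrightarrow> card (diff_coords d x y) \<le> k \<Longrightarrow> diff_coords d x y \<subseteq> B"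
    and "i \<notin> B" "j \<notin> B"
  obtains g where "unate d g" "\<And>x. x \<in> Q \<Longrightarrow> g x = parity2 i j x"
proof -
  define P where "P = {(x, y) \<in> Q \<times> Q. \<not> parity2 i j x \<and> parity2 i j y}"
  have "P \<subseteq> Q \<times> Q" by (auto simp: P_def)
  then have P: "finite P" "card P < 2 ^ k"
    using assms(1,2) card_mono[of "Q \<times> Q" P] finite_subset[of P "Q \<times> Q"]
    by (auto simp: card_cartesian_product)
  have "k \<le> card (diff_coords d x y)" if "(x, y) \<in> P" for x y
  proof (rule ccontr)
    assume "\<not> ?thesis"
    then have "diff_coords d x y \<subseteq> B"
      using that by (intro close) (auto simp: P_def)
    then have "x i = y i" "x j = y j"
      using assms by (auto simp: diff_coords_def)
    with that show False
      by (auto simp: P_def parity2_def)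
  qed
  from orientation_exists[OF P this]
  obtain r where r: "\<And>x y. (x, y) \<in> P \<Longrightarrow> \<exists>i<d. x i \<noteq> y i \<and> y i = r i" by blast
  show ?thesis
    by (rule unate_extension[of Q "parity2 i j" d r]) (use r that in \<open>auto simp: P_def\<close>)
qed

text \<open>Acceptance with probability 1 holds on the whole support, and the decision sees only the
  answers, which \<open>f\<close> shares with \<open>g\<close>.\<close>

lemma one_sided_accepts:
  assumes "one_sided_error d T" "(qs, decide) \<in> set_pmf T" "unate d g" "map f qs = map g qs"
  shows "decide (map f qs)"
proof -
  have "measure_pmf.prob T {(qs, decide). decide (map g qs)} = 1"
    using assms by (simp add: one_sided_error_def accept_prob_def)
  then have "AE p in measure_pmf T. p \<in> {(qs, decide). decide (map g qs)}"
    by (intro measure_pmf.AE_prob_1)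
  then have "decide (map g qs)"
    using assms(2) by (auto simp: AE_measure_pmf_iff)
  then show ?thesis
    by (simp only: assms(4))
qed

text \<open>The parities use disjoint pairs of coordinates, so each coordinate \<open>b\<close>
  varying within close pairs spoils at most one, that of \<open>m = b div 2\<close>.\<close>

lemma card_rejected_parities:
  assumes T: "one_sided_error d T" "(qs, decide) \<in> set_pmf T"
    and n: "length qs \<le> n" "n * n < 2 ^ k"
  shows "card {m \<in> {..<d div 2}. \<not> decide (map (parity2 (2*m) (2*m+1)) qs)} \<le> k * n"
    (is "card ?R \<le> _")
proof -
  obtain B where B: "finite B" "card B \<le> k * card (set qs)"
    "\<And>x y. x \<in> set qs \<Longrightarrow> y \<in> set qs \<Longrightarrow> card (diff_coords d x y) \<le> k \<Longrightarrow> diff_coords d x y \<subseteq> B"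
    by (rule coords_of_close_pairs[of "set qs" k d]) auto
  have le: "card (set qs) \<le> n"
    using n card_length[of qs] by linarith
  then have lt: "card (set qs) * card (set qs) < 2 ^ k"
    using n mult_le_mono[OF le le] by linarith
  have "?R \<subseteq> (\<lambda>b. b div 2) ` B"
  proof
    fix m assume m: "m \<in> ?R"
    have "2*m \<in> B \<or> 2*m+1 \<in> B"
    proof (rule ccontr)
      assume "\<not> ?thesis"
      then have notin: "2*m \<notin> B" "2*m+1 \<notin> B" by auto
      have "2*m < d" "2*m+1 < d" using m by auto
      then obtain g where g: "unate d g" "\<And>x. x \<in> set qs \<Longrightarrow> g x = parity2 (2*m) (2*m+1) x"
        using parity2_extension[OF finite_set lt _ _ B(3) notin] by blast
      have "decide (map (parity2 (2*m) (2*m+1)) qs)"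
        by (rule one_sided_accepts[OF T g(1)]) (simp add: g(2))
      with m show False by blast
    qed
    then show "m \<in> (\<lambda>b. b div 2) ` B"
      by (force simp: image_iff)
  qed
  then have "card ?R \<le> card B"
    using B(1) surj_card_le by blast
  also have "\<dots> \<le> k * n"
    using B(2) le by (meson le_trans mult_le_mono2)
  finally show ?thesis .
qed

section \<open>Query lower bound\<close>

text \<open>Double counting: each parity is rejected with probability at least \<open>2 / 3\<close>,
  while any one strategy in the support rejects at most \<open>k * n\<close> of them.\<close>

lemma tester_query_bound:
  assumes "\<epsilon> \<le> 1 / 4" and T: "nonadaptive_unateness_tester d \<epsilon> T" "one_sided_error d T"
    and n: "\<And>qs decide. (qs, decide) \<in> set_pmf T \<Longrightarrow> length qs \<le> n" "n * n < 2 ^ k"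
  shows "2 / 3 * real (d div 2) \<le> real (k * n)"
proof -
  define A where "A m = {(qs, decide). \<not> (decide :: bool list \<Rightarrow> bool) (map (parity2 (2*m) (2*m+1)) qs)}"
    for m
  have "2 / 3 * real (d div 2) = (\<Sum>m<d div 2. 2 / 3)"
    by simp
  also have "\<dots> \<le> (\<Sum>m<d div 2. measure_pmf.prob T (A m))"
  proof (rule sum_mono)
    fix m assume "m \<in> {..<d div 2}"
    then have "far_from_unate d \<epsilon> (parity2 (2*m) (2*m+1))"
      using assms(1) by (intro parity2_far_from_unate) auto
    with T show "2 / 3 \<le> measure_pmf.prob T (A m)"
      by (simp add: nonadaptive_unateness_tester_def reject_prob_def A_def)
  qed
  also have "\<dots> = measure_pmf.expectation T (\<lambda>p. \<Sum>m<d div 2. indicator (A m) p)"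
    by (subst Bochner_Integration.integral_sum) (auto simp: integrable_real_indicator less_top[symmetric])
  also have "\<dots> \<le> measure_pmf.expectation T (\<lambda>p. real (k * n))"
  proof (rule integral_mono_AE)
    show "integrable T (\<lambda>p. \<Sum>m<d div 2. indicator (A m) p :: real)"
      by (auto simp: integrable_real_indicator less_top[symmetric])
    show "AE p in T. (\<Sum>m<d div 2. indicator (A m) p :: real) \<le> real (k * n)"
    proof (simp only: AE_measure_pmf_iff, intro ballI)
      fix p assume "p \<in> set_pmf T"
      then obtain qs decide where p: "p = (qs, decide)" "(qs, decide) \<in> set_pmf T"
        by (cases p) auto
      have "(\<Sum>m<d div 2. indicator (A m) p :: real) = real (card {m \<in> {..<d div 2}. p \<in> A m})"
        by (simp add: indicator_def sum.If_cases Int_def)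
      also have "\<dots> \<le> real (k * n)"
        using card_rejected_parities[OF T(2) p(2) n(1)[OF p(2)] n(2)] p(1)
        by (simp only: A_def mem_Collect_eq prod.case of_nat_le_iff)
      finally show "(\<Sum>m<d div 2. indicator (A m) p :: real) \<le> real (k * n)" .
    qed
  qed simp
  finally show ?thesis by simp
qed

lemma query_lower_bound:
  assumes "d \<ge> 2" "\<epsilon> \<le> 1 / 4" and T: "nonadaptive_unateness_tester d \<epsilon> T" "one_sided_error d T"
    and n: "\<And>qs decide. (qs, decide) \<in> set_pmf T \<Longrightarrow> length qs \<le> n"
  shows "1 / 24 * (real d / log 2 (real d)) \<le> real n"
proof -
  define l where "l = log 2 (real d)"
  have l: "l \<ge> 1"
    using \<open>d \<ge> 2\<close> by (simp add: l_def le_log_iff)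
  have "real d \<le> 24 * l * real n"
  proof (cases "n < d")
    case True
    \<comment> \<open>Rounding up costs a factor of at most 2 because \<open>l \<ge> 1\<close>.
      Taking \<open>k = 2 * L\<close> makes room for the square of \<open>n\<close>.\<close>
    define L where "L = nat \<lceil>l\<rceil>"
    have L: "l \<le> real L" "real L \<le> 2 * l"
      using l le_of_int_ceiling[of l] of_int_ceiling_le_add_one[of l]
      by (simp_all add: L_def del: of_int_ceiling_le_add_one)
    have "real d \<le> 2 powr real L"
      using L(1) \<open>d \<ge> 2\<close> by (simp add: l_def log_le_iff)
    then have "d \<le> 2 ^ L"
      by (simp add: powr_realpow)
    with True have "n < 2 ^ L" by simp
    then have "n * n < 2 ^ L * 2 ^ L"
      by (intro mult_strict_mono) auto
    then have "n * n < 2 ^ (2 * L)"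
      by (simp add: mult_2 power_add)
    from tester_query_bound[OF assms(2) T n this]
    have *: "2 / 3 * real (d div 2) \<le> 2 * (real L * real n)"
      by simp
    have "real L * real n \<le> 2 * l * real n"
      using L by (intro mult_right_mono) auto
    moreover have "real d \<le> 4 * real (d div 2)"
      using \<open>d \<ge> 2\<close> by linarith
    \<comment> \<open>Together these give \<open>d / 6 \<le> 4 * l * n\<close>, whence the constant
      24.\<close>
    ultimately show ?thesis using * by linarith
  next
    case False
    then have "real d \<le> real n" by simp
    also have "\<dots> \<le> 24 * l * real n"
      using l mult_right_mono[of 1 "24 * l" "real n"] by simp
    finally show ?thesis .
  qed
  then show ?thesis
    using l by (simp add: l_def[symmetric] field_simps)
qed

theorem theorem1:
  "\<exists>c::real. c > 0 \<and>
     (\<forall>\<^sub>F d in sequentially. \<forall>\<epsilon>::real. 0 < \<epsilon> \<and> \<epsilon> \<le> 1 / 8 \<longrightarrow>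
        (\<forall>T. nonadaptive_unateness_tester d \<epsilon> T \<and> one_sided_error d T \<longrightarrow>
           ereal (c * (real d / log 2 (real d))) \<le> ereal_of_enat (num_queries T)))"
proof (intro exI[of _ "1 / 24"] conjI eventually_sequentiallyI[of 2] allI impI)
  fix d :: nat and \<epsilon> :: real and T
  assume d: "2 \<le> d" and \<epsilon>: "0 < \<epsilon> \<and> \<epsilon> \<le> 1 / 8"
    and T: "nonadaptive_unateness_tester d \<epsilon> T \<and> one_sided_error d T"
  show "ereal (1 / 24 * (real d / log 2 (real d))) \<le> ereal_of_enat (num_queries T)"
  proof (cases "num_queries T")
    case (enat n)
    have "length qs \<le> n" if "(qs, decide) \<in> set_pmf T" for qs decide
    proof -
      have "enat (length qs) \<le> num_queries T"
        using SUP_upper[OF that, of "\<lambda>(qs, decide). enat (length qs)"]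
        by (simp add: num_queries_def)
      then show ?thesis by (simp add: enat)
    qed
    then show ?thesis
      using query_lower_bound[OF d, of \<epsilon> T n] \<epsilon> T by (simp add: enat)
  qed simp
qed simp

end
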